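(* Let $n\geq 1$ be a positive integer, let $A=\mathbb{Z}/n\mathbb{Z}$, and let $G=A\rtimes A^\times$ be the holomorph of $A$. For $a\in A$ and $u\in A^\times$ let $T_{a,u}:A\to A$ denote the affine transformation $x\mapsto a+ux$. Let $T_{a,u}$ and $T_{b,v}$ (with $a,b\in A$ and $u,v\in A^\times$) be virtual structures on the dihedral quandle $R_n$ of order $n$. Then $(R_n,T_{a,u})\cong(R_n,T_{b,v})$ as virtual racks if and only if $u=v$ and $$b=ya+(1-u)x$$ for some element $(x,y)\in G$ (that is, for some $x\in A$ and $y\in A^\times$).
   Context: Composition of maps is written $\psi\chi$ (first $\chi$, then $\psi$). For a set $X$, $S_X$ denotes the symmetric group of $X$ (all bijections $X\to X$). $A^\times=(\mathbb{Z}/n\mathbb{Z})^\times$ is the multiplicative group of units, and the elements of $G=A\rtimes A^\times$ are the pairs $(x,y)$ with $x\in A$, $y\in A^\times$. A rack is a pair $R=(X,s)$ where $X$ is a set and $s:X\to S_X$, $x\mapsto s_x$, is a map such that $s_xs_y=s_{s_x(y)}s_x$ for all $x,y\in X$. It is a quandle if in addition $s_x(x)=x$ for all $x\in X$. The dihedral quandle $R_n$ of order $n$ is the quandle $(\mathbb{Z}/n\mathbb{Z},s)$ with $s_g(h)=2g-h$ for all $g,h\in\mathbb{Z}/n\mathbb{Z}$. A rack homomorphism from $(X,s)$ to $(Y,t)$ is a map $\psi:X\to Y$ with $\psi s_x=t_{\psi(x)}\psi$ for all $x\in X$. A rack isomorphism is a bijective rack homomorphism; an automorphism of a rack $R$ is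 an isomorphism from $R$ to itself; and $\operatorname{Aut} R$ is the group of automorphisms of $R$ under composition. A virtual rack is a pair $(R,f)$ where $R$ is a rack and $f\in\operatorname{Aut}R$; $f$ is called a virtual structure on $R$. It is a known fact that the virtual structures on $R_n$ are precisely the affine transformations $T_{a,u}$ with $a\in A$, $u\in A^\times$. A virtual rack homomorphism from $(R_1,f_1)$ to $(R_2,f_2)$ is a rack homomorphism $\psi$ from $R_1$ to $R_2$ with $\psi f_1=f_2\psi$; a virtual rack isomorphism is a bijective virtual rack homomorphism, and $\cong$ denotes existence of such an isomorphism. *)

theory Defs
  imports "HOL-Algebra.IntRing" "HOL-Algebra.Bij"
begin

text \<open>A rack is a pair of a carrier set and the map \<open>x \<mapsto> s\<^sub>x\<close>. As in \<open>HOL-Algebra.Bij\<close>,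
  the elements of the symmetric group \<open>Bij X\<close> are extensional functions, and composition on
  \<open>X\<close> is \<^term>\<open>compose X\<close>.\<close>

type_synonym 'a rack = "'a set \<times> ('a \<Rightarrow> 'a \<Rightarrow> 'a)"

type_synonym 'a virtual_rack = "'a rack \<times> ('a \<Rightarrow> 'a)"

fun rack :: "'a rack \<Rightarrow> bool" where
  "rack (X, s) \<longleftrightarrow> s \<in> X \<rightarrow> Bij X \<and>
    (\<forall>x\<in>X. \<forall>y\<in>X. compose X (s x) (s y) = compose X (s (s x y)) (s x))"

fun quandle :: "'a rack \<Rightarrow> bool" where
  "quandle (X, s) \<longleftrightarrow> rack (X, s) \<and> (\<forall>x\<in>X. s x x = x)"

fun rack_hom :: "'a rack \<Rightarrow> 'b rack \<Rightarrow> ('a \<Rightarrow> 'b) set" where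
  "rack_hom (X, s) (Y, t) =
    {\<psi> \<in> X \<rightarrow>\<^sub>E Y. \<forall>x\<in>X. compose X \<psi> (s x) = compose X (t (\<psi> x)) \<psi>}"

definition rack_iso :: "'a rack \<Rightarrow> 'b rack \<Rightarrow> ('a \<Rightarrow> 'b) set" where
  "rack_iso R S = {\<psi> \<in> rack_hom R S. bij_betw \<psi> (fst R) (fst S)}"

definition rack_Aut :: "'a rack \<Rightarrow> ('a \<Rightarrow> 'a) monoid" where
  "rack_Aut R = BijGroup (fst R) \<lparr>carrier := rack_iso R R\<rparr>"

fun virtual_rack :: "'a virtual_rack \<Rightarrow> bool" where
  "virtual_rack (R, f) \<longleftrightarrow> rack R \<and> f \<in> carrier (rack_Aut R)"

fun virtual_rack_hom :: "'a virtual_rack \<Rightarrow> 'b virtual_rack \<Rightarrow> ('a \<Rightarrow> 'b) set" where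
  "virtual_rack_hom (R, f) (S, g) =
    {\<psi> \<in> rack_hom R S. compose (fst R) \<psi> f = compose (fst R) g \<psi>}"

definition virtual_rack_iso :: "'a virtual_rack \<Rightarrow> 'b virtual_rack \<Rightarrow> ('a \<Rightarrow> 'b) set" where
  "virtual_rack_iso V W =
    {\<psi> \<in> virtual_rack_hom V W. bij_betw \<psi> (fst (fst V)) (fst (fst W))}"

definition virtual_rack_isomorphic :: "'a virtual_rack \<Rightarrow> 'b virtual_rack \<Rightarrow> bool"
    (infix \<open>\<cong>\<^sub>v\<close> 50) where
  "V \<cong>\<^sub>v W \<longleftrightarrow> virtual_rack_iso V W \<noteq> {}"

text \<open>Unlike the ring on \<open>{0..m - 1}\<close> of \<open>HOL-Number_Theory.Residues\<close>, the quotient ring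
  \<^const>\<open>ZFact\<close> is also correct for modulus 1, where it is the zero ring with trivial
  unit group.\<close>

abbreviation Zmod :: "nat \<Rightarrow> int set ring" where
  "Zmod n \<equiv> ZFact (int n)"

definition dihedral_quandle :: "nat \<Rightarrow> int set rack" where
  "dihedral_quandle n = (carrier (Zmod n),
    \<lambda>g\<in>carrier (Zmod n). \<lambda>h\<in>carrier (Zmod n). (g \<oplus>\<^bsub>Zmod n\<^esub> g) \<ominus>\<^bsub>Zmod n\<^esub> h)"

definition affine_map :: "nat \<Rightarrow> int set \<Rightarrow> int set \<Rightarrow> int set \<Rightarrow> int set" where
  "affine_map n a u = (\<lambda>x\<in>carrier (Zmod n). a \<oplus>\<^bsub>Zmod n\<^esub> (u \<otimes>\<^bsub>Zmod n\<^esub> x))"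

definition holomorph :: "nat \<Rightarrow> (int set \<times> int set) monoid" where
  "holomorph n =
    \<lparr>carrier = carrier (Zmod n) \<times> Units (Zmod n),
     mult = \<lambda>(x, y) (x', y'). (x \<oplus>\<^bsub>Zmod n\<^esub> (y \<otimes>\<^bsub>Zmod n\<^esub> x'), y \<otimes>\<^bsub>Zmod n\<^esub> y'),
     one = (\<zero>\<^bsub>Zmod n\<^esub>, \<one>\<^bsub>Zmod n\<^esub>)\<rparr>"

lemma group_holomorph: "group (holomorph n)"
proof -
  interpret cring "Zmod n" by (rule ZFact_is_cring)
  show ?thesis
    unfolding holomorph_def
  proof (rule groupI, goal_cases)
    case (5 p)
    then obtain x y where p: "p = (x, y)" "x \<in> carrier (Zmod n)" "y \<in> Units (Zmod n)"
      by auto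
    let ?q = "(\<ominus>\<^bsub>Zmod n\<^esub> (inv\<^bsub>Zmod n\<^esub> y \<otimes>\<^bsub>Zmod n\<^esub> x), inv\<^bsub>Zmod n\<^esub> y)"
    show ?case
      using p by (intro bexI[of _ ?q]) (auto simp: Units_l_inv l_neg)
  qed (auto simp: r_distr m_assoc a_assoc Units_closed)
qed

lemma quandle_dihedral_quandle: "quandle (dihedral_quandle n)"
proof -
  interpret cring "Zmod n" by (rule ZFact_is_cring)
  let ?A = "carrier (Zmod n)"
  let ?s = "\<lambda>g h. (g \<oplus>\<^bsub>Zmod n\<^esub> g) \<ominus>\<^bsub>Zmod n\<^esub> h"
  have inv: "?s g (?s g h) = h" if "g \<in> ?A" "h \<in> ?A" for g h
    using that by algebra
  have "bij_betw (?s g) ?A ?A" if "g \<in> ?A" for g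
    by (rule bij_betw_byWitness[where f' = "?s g"]) (use that inv in auto)
  then have bij: "(\<lambda>h\<in>?A. ?s g h) \<in> Bij ?A" if "g \<in> ?A" for g
    using that by (simp add: Bij_def)
  have dist: "?s x (?s y z) = ?s (?s x y) (?s x z)"
    if "x \<in> ?A" "y \<in> ?A" "z \<in> ?A" for x y z
    using that by algebra
  have idem: "?s x x = x" if "x \<in> ?A" for x
    using that by algebra
  have comp: "compose ?A (\<lambda>h\<in>?A. ?s x h) (\<lambda>h\<in>?A. ?s y h) =
      compose ?A (\<lambda>h\<in>?A. ?s (?s x y) h) (\<lambda>h\<in>?A. ?s x h)" if "x \<in> ?A" "y \<in> ?A" for x y
    unfolding compose_def by (rule restrict_ext) (use that dist[OF that] in simp)
  show ?thesis
    unfolding dihedral_quandle_def quandle.simps rack.simps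
  proof (intro conjI ballI funcsetI)
    fix x y assume "x \<in> ?A" "y \<in> ?A"
    then show "compose ?A ((\<lambda>g\<in>?A. \<lambda>h\<in>?A. ?s g h) x) ((\<lambda>g\<in>?A. \<lambda>h\<in>?A. ?s g h) y) =
      compose ?A ((\<lambda>g\<in>?A. \<lambda>h\<in>?A. ?s g h) ((\<lambda>g\<in>?A. \<lambda>h\<in>?A. ?s g h) x y))
        ((\<lambda>g\<in>?A. \<lambda>h\<in>?A. ?s g h) x)"
      using comp[of x y] by simp
  qed (use bij idem in simp_all)
qed

lemma virtual_rack_affine_map:
  assumes "a \<in> carrier (Zmod n)" "u \<in> Units (Zmod n)"
  shows "virtual_rack (dihedral_quandle n, affine_map n a u)"
proof -
  interpret cring "Zmod n" by (rule ZFact_is_cring)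
  let ?A = "carrier (Zmod n)"
  let ?s = "\<lambda>g h. (g \<oplus>\<^bsub>Zmod n\<^esub> g) \<ominus>\<^bsub>Zmod n\<^esub> h"
  let ?T = "\<lambda>x. a \<oplus>\<^bsub>Zmod n\<^esub> (u \<otimes>\<^bsub>Zmod n\<^esub> x)"
  let ?T' = "\<lambda>x. inv\<^bsub>Zmod n\<^esub> u \<otimes>\<^bsub>Zmod n\<^esub> (x \<ominus>\<^bsub>Zmod n\<^esub> a)"
  have u: "u \<in> ?A" "inv\<^bsub>Zmod n\<^esub> u \<in> ?A" "inv\<^bsub>Zmod n\<^esub> u \<otimes>\<^bsub>Zmod n\<^esub> u = \<one>\<^bsub>Zmod n\<^esub>"
    "u \<otimes>\<^bsub>Zmod n\<^esub> inv\<^bsub>Zmod n\<^esub> u = \<one>\<^bsub>Zmod n\<^esub>"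
    using assms by auto
  have T'T: "?T' (?T x) = x" and TT': "?T (?T' x) = x" if x: "x \<in> ?A" for x
  proof -
    have "?T x \<ominus>\<^bsub>Zmod n\<^esub> a = u \<otimes>\<^bsub>Zmod n\<^esub> x"
      using assms(1) u(1) x by algebra
    then show "?T' (?T x) = x"
      using u x by (simp flip: m_assoc)
    have "u \<otimes>\<^bsub>Zmod n\<^esub> ?T' x = x \<ominus>\<^bsub>Zmod n\<^esub> a"
      using assms(1) u x by (simp flip: m_assoc)
    then show "?T (?T' x) = x"
      using assms(1) x by (simp, algebra)
  qed
  have bij: "bij_betw (affine_map n a u) ?A ?A"
    unfolding affine_map_def
    by (rule bij_betw_byWitness[where f' = ?T']) (use assms u T'T TT' in auto)
  have hom: "?T (?s x y) = ?s (?T x) (?T y)" if "x \<in> ?A" "y \<in> ?A" for x y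
    using that assms(1) u(1) by algebra
  have "affine_map n a u \<in> rack_hom (dihedral_quandle n) (dihedral_quandle n)"
    using assms(1) u(1) hom
    by (auto simp: dihedral_quandle_def affine_map_def compose_def cong: restrict_cong)
  moreover have "rack (dihedral_quandle n)"
    using quandle_dihedral_quandle[of n] by (cases "dihedral_quandle n") (simp only: quandle.simps)
  moreover have "fst (dihedral_quandle n) = ?A"
    by (simp add: dihedral_quandle_def)
  ultimately show ?thesis
    using bij by (simp add: rack_Aut_def rack_iso_def)
qed

end

theory Submission
  imports Defs
begin

text \<open>A quandle endomorphism \<open>\<psi>\<close> of the dihedral quandle satisfies \<open>\<psi> (2g - h) = 2 \<psi> g - \<psi> h\<close>.
  Taking \<open>g = k + 1\<close> and \<open>h = k\<close> shows that consecutive differences of \<open>\<psi>\<close> along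
  \<open>\<dots>, -1, 0, 1, 2, \<dots>\<close> are all equal; since \<open>1\<close> generates \<open>\<int>/n\<close> additively, \<open>\<psi>\<close> is an
  arithmetic progression, that is, an affine map \<open>z \<mapsto> x + yz\<close>
  (\<open>dihedral_hom_is_affine\<close>). It is bijective exactly when \<open>y\<close> is a unit, so the automorphisms of
  the dihedral quandle are the affine maps with unit slope (\<open>rack_iso_dihedral_quandle\<close>).

  Such an affine map is an isomorphism of the two virtual racks when it intertwines the two virtual
  structures. Both composites are affine again, with intercepts \<open>x + ya\<close> and \<open>b + vx\<close> and slopes
  \<open>yu\<close> and \<open>vy\<close>. As an affine map determines its intercept and slope, the intertwining condition is
  the pair of equations \<open>x + ya = b + vx\<close> and \<open>yu = vy\<close>; cancelling the unit \<open>y\<close> in the latter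
  leaves \<open>u = v\<close>, after which the former is \<open>b = ya + (1 - u)x\<close>
  (\<open>affine_map_intertwine_iff\<close>).\<close>

lemma cring_Zmod: "cring (Zmod n)"
  by (rule ZFact_is_cring)

text \<open>The residue map lets statements about \<open>\<int>/n\<close> be proved by induction on the integers, in both
  directions from \<open>0\<close>.\<close>

lemma Zmod_residue_map:
  obtains \<rho> :: "int \<Rightarrow> int set"
  where "\<rho> \<in> ring_hom \<Z> (Zmod n)" "\<rho> ` UNIV = carrier (Zmod n)"
proof
  let ?I = "Idl\<^bsub>\<Z>\<^esub> {int n}"
  interpret ideal ?I \<Z>
    by (rule int.genideal_ideal) simp
  show "(+>\<^bsub>\<Z>\<^esub>) ?I \<in> ring_hom \<Z> (Zmod n)"
    unfolding ZFact_def by (rule rcos_ring_hom)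
  show "range ((+>\<^bsub>\<Z>\<^esub>) ?I) = carrier (Zmod n)"
    by (auto simp: ZFact_def FactRing_def A_RCOSETS_def')
qed

lemma rack_hom_dihedral_quandle_iff:
  "\<psi> \<in> rack_hom (dihedral_quandle n) (dihedral_quandle n) \<longleftrightarrow>
    \<psi> \<in> carrier (Zmod n) \<rightarrow>\<^sub>E carrier (Zmod n) \<and>
    (\<forall>g\<in>carrier (Zmod n). \<forall>h\<in>carrier (Zmod n).
      \<psi> ((g \<oplus>\<^bsub>Zmod n\<^esub> g) \<ominus>\<^bsub>Zmod n\<^esub> h) = (\<psi> g \<oplus>\<^bsub>Zmod n\<^esub> \<psi> g) \<ominus>\<^bsub>Zmod n\<^esub> \<psi> h)"
  unfolding dihedral_quandle_def rack_hom.simps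
  by (auto simp: compose_def restrict_def fun_eq_iff PiE_mem; metis PiE_mem)

text \<open>Read along the integers, the homomorphism law says that reflecting \<open>l\<close> in \<open>k\<close> is preserved.
  Consecutive values therefore determine the next one and the previous one, as they do for an
  arithmetic progression.\<close>

theorem dihedral_hom_is_affine:
  assumes hom: "\<psi> \<in> rack_hom (dihedral_quandle n) (dihedral_quandle n)"
  shows "\<psi> = affine_map n (\<psi> \<zero>\<^bsub>Zmod n\<^esub>) (\<psi> \<one>\<^bsub>Zmod n\<^esub> \<ominus>\<^bsub>Zmod n\<^esub> \<psi> \<zero>\<^bsub>Zmod n\<^esub>)"
proof -
  interpret cring "Zmod n" by (rule cring_Zmod)
  let ?R = "Zmod n"
  obtain \<rho> where \<rho>: "\<rho> \<in> ring_hom \<Z> ?R" "\<rho> ` UNIV = carrier ?R"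
    by (rule Zmod_residue_map)
  interpret \<rho>: ring_hom_cring \<Z> ?R \<rho>
    by (intro ring_hom_cringI ring_hom_ringI2 \<rho>(1) int_is_cring is_cring int.ring_axioms ring_axioms)
  have \<rho>_simps: "\<rho> k \<in> carrier ?R" "\<rho> 0 = \<zero>\<^bsub>?R\<^esub>" "\<rho> 1 = \<one>\<^bsub>?R\<^esub>"
    "\<rho> (k + l) = \<rho> k \<oplus>\<^bsub>?R\<^esub> \<rho> l" "\<rho> (k - l) = \<rho> k \<ominus>\<^bsub>?R\<^esub> \<rho> l" for k l
    using \<rho>(2) \<rho>.hom_zero \<rho>.hom_one \<rho>.hom_add[of k l]
      \<rho>.hom_add[of k "- l"] \<rho>.hom_a_inv[of l]
    by (auto simp: minus_eq)
  define p where "p k = \<psi> (\<rho> k)" for k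
  define d where "d = p 1 \<ominus>\<^bsub>?R\<^esub> p 0"
  have p_closed: "p k \<in> carrier ?R" for k
    using hom \<rho>_simps(1) unfolding p_def rack_hom_dihedral_quandle_iff by auto
  have d_closed: "d \<in> carrier ?R"
    using p_closed by (simp add: d_def)
  have reflect: "p (k + k - l) = (p k \<oplus>\<^bsub>?R\<^esub> p k) \<ominus>\<^bsub>?R\<^esub> p l" for k l
    using hom \<rho>_simps(1) unfolding p_def rack_hom_dihedral_quandle_iff
    by (simp only: \<rho>_simps(4,5))
  have step: "p (k + 1) = p k \<oplus>\<^bsub>?R\<^esub> d" for k
  proof (induction k rule: int_induct[where k = 0])
    case base
    show ?case using p_closed[of 0] p_closed[of 1] unfolding d_def by simp algebra
  next
    case (step1 k)
    have "p (k + 1 + 1) = (p (k + 1) \<oplus>\<^bsub>?R\<^esub> p (k + 1)) \<ominus>\<^bsub>?R\<^esub> p k"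
      using reflect[of "k + 1" k] by (simp add: algebra_simps)
    then show ?case
      unfolding step1.IH using p_closed[of k] d_closed by algebra
  next
    case (step2 k)
    have "p (k - 1) = (p k \<oplus>\<^bsub>?R\<^esub> p k) \<ominus>\<^bsub>?R\<^esub> p (k + 1)"
      using reflect[of k "k + 1"] by (simp add: algebra_simps)
    then show ?case
      unfolding step2.IH using p_closed[of k] d_closed by simp algebra
  qed
  have progression: "p k = p 0 \<oplus>\<^bsub>?R\<^esub> d \<otimes>\<^bsub>?R\<^esub> \<rho> k" for k
  proof (induction k rule: int_induct[where k = 0])
    case base
    show ?case using p_closed[of 0] d_closed by (simp add: \<rho>_simps)
  next
    case (step1 k)
    show ?case
      unfolding step[of k] step1.IH \<rho>_simps(3,4)
      using p_closed[of 0] d_closed \<rho>_simps(1)[of k] by (simp add: r_distr a_assoc)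
  next
    case (step2 k)
    have "p (k - 1) = p k \<ominus>\<^bsub>?R\<^esub> d"
      using step[of "k - 1"] p_closed[of "k - 1"] d_closed by simp algebra
    then show ?case
      unfolding step2.IH \<rho>_simps(3,5)
      using p_closed[of 0] d_closed \<rho>_simps(1)[of k]
      by (simp add: minus_eq r_distr r_minus a_assoc)
  qed
  show ?thesis
  proof (rule extensionalityI)
    show "\<psi> \<in> extensional (carrier ?R)"
      using hom by (simp add: rack_hom_dihedral_quandle_iff PiE_def)
    show "\<psi> z = affine_map n (\<psi> \<zero>\<^bsub>?R\<^esub>) (\<psi> \<one>\<^bsub>?R\<^esub> \<ominus>\<^bsub>?R\<^esub> \<psi> \<zero>\<^bsub>?R\<^esub>) z"
      if z: "z \<in> carrier ?R" for z
    proof -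
      obtain k where "z = \<rho> k"
        using z \<rho>(2) by auto
      then show ?thesis
        using z progression[of k] by (simp add: affine_map_def d_def p_def \<rho>_simps(2,3))
    qed
  qed (simp add: affine_map_def)
qed

text \<open>Surjectivity alone forces the slope to be a unit: a preimage \<open>z\<close> of \<open>x + 1\<close> satisfies
  \<open>yz = 1\<close>.\<close>

lemma affine_map_surj_imp_Unit:
  assumes "x \<in> carrier (Zmod n)" "y \<in> carrier (Zmod n)"
    and surj: "affine_map n x y ` carrier (Zmod n) = carrier (Zmod n)"
  shows "y \<in> Units (Zmod n)"
proof -
  interpret cring "Zmod n" by (rule cring_Zmod)
  have "x \<oplus>\<^bsub>Zmod n\<^esub> \<one>\<^bsub>Zmod n\<^esub> \<in> affine_map n x y ` carrier (Zmod n)"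
    using assms by simp
  then obtain z where z: "z \<in> carrier (Zmod n)"
    and "x \<oplus>\<^bsub>Zmod n\<^esub> \<one>\<^bsub>Zmod n\<^esub> = x \<oplus>\<^bsub>Zmod n\<^esub> y \<otimes>\<^bsub>Zmod n\<^esub> z"
    by (auto simp: affine_map_def)
  then have "y \<otimes>\<^bsub>Zmod n\<^esub> z = \<one>\<^bsub>Zmod n\<^esub>"
    using assms(1,2) by (metis a_comm add.right_cancel m_closed one_closed)
  then show ?thesis
    using assms(2) z m_comm[of y z] by (auto simp: Units_def)
qed

theorem rack_iso_dihedral_quandle:
  "rack_iso (dihedral_quandle n) (dihedral_quandle n) =
    {affine_map n x y | x y. x \<in> carrier (Zmod n) \<and> y \<in> Units (Zmod n)}"
proof (intro equalityI subsetI)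
  interpret cring "Zmod n" by (rule cring_Zmod)
  fix \<psi> assume "\<psi> \<in> rack_iso (dihedral_quandle n) (dihedral_quandle n)"
  then have hom: "\<psi> \<in> rack_hom (dihedral_quandle n) (dihedral_quandle n)"
    and surj: "\<psi> ` carrier (Zmod n) = carrier (Zmod n)"
    by (auto simp: rack_iso_def dihedral_quandle_def bij_betw_def)
  let ?x = "\<psi> \<zero>\<^bsub>Zmod n\<^esub>" and ?y = "\<psi> \<one>\<^bsub>Zmod n\<^esub> \<ominus>\<^bsub>Zmod n\<^esub> \<psi> \<zero>\<^bsub>Zmod n\<^esub>"
  have closed: "?x \<in> carrier (Zmod n)" "?y \<in> carrier (Zmod n)"
    using surj by auto
  have \<psi>: "\<psi> = affine_map n ?x ?y"
    by (rule dihedral_hom_is_affine[OF hom])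
  have "?y \<in> Units (Zmod n)"
    by (rule affine_map_surj_imp_Unit[OF closed]) (use surj \<psi> in simp)
  with \<psi> closed show
    "\<psi> \<in> {affine_map n x y | x y. x \<in> carrier (Zmod n) \<and> y \<in> Units (Zmod n)}"
    by blast
next
  fix \<psi> assume "\<psi> \<in> {affine_map n x y | x y. x \<in> carrier (Zmod n) \<and> y \<in> Units (Zmod n)}"
  then show "\<psi> \<in> rack_iso (dihedral_quandle n) (dihedral_quandle n)"
    using virtual_rack_affine_map by (auto simp: rack_Aut_def)
qed

lemma compose_affine_map:
  assumes "x \<in> carrier (Zmod n)" "y \<in> carrier (Zmod n)"
    and "a \<in> carrier (Zmod n)" "u \<in> carrier (Zmod n)"
  shows "compose (carrier (Zmod n)) (affine_map n x y) (affine_map n a u) =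
    affine_map n (x \<oplus>\<^bsub>Zmod n\<^esub> y \<otimes>\<^bsub>Zmod n\<^esub> a) (y \<otimes>\<^bsub>Zmod n\<^esub> u)"
proof -
  interpret cring "Zmod n" by (rule cring_Zmod)
  show ?thesis
    using assms
    by (auto simp: compose_def affine_map_def restrict_def fun_eq_iff r_distr a_assoc m_assoc)
qed

text \<open>The intercept is the value at \<open>0\<close>, and the value at \<open>1\<close> then determines the slope.\<close>

lemma affine_map_eq_iff:
  assumes "a \<in> carrier (Zmod n)" "u \<in> carrier (Zmod n)"
    and "b \<in> carrier (Zmod n)" "v \<in> carrier (Zmod n)"
  shows "affine_map n a u = affine_map n b v \<longleftrightarrow> a = b \<and> u = v"
proof
  interpret cring "Zmod n" by (rule cring_Zmod)
  assume eq: "affine_map n a u = affine_map n b v"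
  have "a = b"
    using fun_cong[OF eq, of "\<zero>\<^bsub>Zmod n\<^esub>"] assms by (simp add: affine_map_def)
  moreover have "a \<oplus>\<^bsub>Zmod n\<^esub> u = b \<oplus>\<^bsub>Zmod n\<^esub> v"
    using fun_cong[OF eq, of "\<one>\<^bsub>Zmod n\<^esub>"] assms by (simp add: affine_map_def)
  ultimately show "a = b \<and> u = v"
    using assms by (metis a_comm add.right_cancel)
qed simp

lemma affine_map_intertwine_iff:
  assumes x: "x \<in> carrier (Zmod n)" and y: "y \<in> Units (Zmod n)"
    and a: "a \<in> carrier (Zmod n)" and u: "u \<in> carrier (Zmod n)"
    and b: "b \<in> carrier (Zmod n)" and v: "v \<in> carrier (Zmod n)"
  shows "compose (carrier (Zmod n)) (affine_map n x y) (affine_map n a u) =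
      compose (carrier (Zmod n)) (affine_map n b v) (affine_map n x y) \<longleftrightarrow>
    u = v \<and> b = (y \<otimes>\<^bsub>Zmod n\<^esub> a) \<oplus>\<^bsub>Zmod n\<^esub> ((\<one>\<^bsub>Zmod n\<^esub> \<ominus>\<^bsub>Zmod n\<^esub> u) \<otimes>\<^bsub>Zmod n\<^esub> x)"
proof -
  interpret cring "Zmod n" by (rule cring_Zmod)
  let ?R = "Zmod n"
  have y': "y \<in> carrier ?R"
    using y by (rule Units_closed)
  have slope: "y \<otimes>\<^bsub>?R\<^esub> u = v \<otimes>\<^bsub>?R\<^esub> y \<longleftrightarrow> u = v"
    using Units_l_cancel[OF y u v] m_comm[OF v y'] by simp
  have intercept: "x \<oplus>\<^bsub>?R\<^esub> y \<otimes>\<^bsub>?R\<^esub> a = b \<oplus>\<^bsub>?R\<^esub> u \<otimes>\<^bsub>?R\<^esub> x \<longleftrightarrow>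
      b = (y \<otimes>\<^bsub>?R\<^esub> a) \<oplus>\<^bsub>?R\<^esub> ((\<one>\<^bsub>?R\<^esub> \<ominus>\<^bsub>?R\<^esub> u) \<otimes>\<^bsub>?R\<^esub> x)"
  proof
    assume eq: "x \<oplus>\<^bsub>?R\<^esub> y \<otimes>\<^bsub>?R\<^esub> a = b \<oplus>\<^bsub>?R\<^esub> u \<otimes>\<^bsub>?R\<^esub> x"
    have "b = (b \<oplus>\<^bsub>?R\<^esub> u \<otimes>\<^bsub>?R\<^esub> x) \<ominus>\<^bsub>?R\<^esub> u \<otimes>\<^bsub>?R\<^esub> x"
      using b u x by algebra
    also have "\<dots> = (y \<otimes>\<^bsub>?R\<^esub> a) \<oplus>\<^bsub>?R\<^esub> ((\<one>\<^bsub>?R\<^esub> \<ominus>\<^bsub>?R\<^esub> u) \<otimes>\<^bsub>?R\<^esub> x)"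
      unfolding eq[symmetric] using a y' u x by algebra
    finally show "b = (y \<otimes>\<^bsub>?R\<^esub> a) \<oplus>\<^bsub>?R\<^esub> ((\<one>\<^bsub>?R\<^esub> \<ominus>\<^bsub>?R\<^esub> u) \<otimes>\<^bsub>?R\<^esub> x)" .
  next
    assume eq: "b = (y \<otimes>\<^bsub>?R\<^esub> a) \<oplus>\<^bsub>?R\<^esub> ((\<one>\<^bsub>?R\<^esub> \<ominus>\<^bsub>?R\<^esub> u) \<otimes>\<^bsub>?R\<^esub> x)"
    show "x \<oplus>\<^bsub>?R\<^esub> y \<otimes>\<^bsub>?R\<^esub> a = b \<oplus>\<^bsub>?R\<^esub> u \<otimes>\<^bsub>?R\<^esub> x"
      unfolding eq using a y' u x by algebra
  qed
  show ?thesis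
    using x y' a u b v slope intercept
    by (auto simp: compose_affine_map affine_map_eq_iff)
qed

theorem proposition21:
  fixes n :: nat and a b u v :: "int set"
  assumes "n \<ge> 1"
    and "a \<in> carrier (Zmod n)" and "u \<in> Units (Zmod n)"
    and "b \<in> carrier (Zmod n)" and "v \<in> Units (Zmod n)"
    and "virtual_rack (dihedral_quandle n, affine_map n a u)"
    and "virtual_rack (dihedral_quandle n, affine_map n b v)"
  shows "(dihedral_quandle n, affine_map n a u) \<cong>\<^sub>v (dihedral_quandle n, affine_map n b v) \<longleftrightarrow>
    u = v \<and>
    (\<exists>(x, y)\<in>carrier (holomorph n).
      b = (y \<otimes>\<^bsub>Zmod n\<^esub> a) \<oplus>\<^bsub>Zmod n\<^esub> ((\<one>\<^bsub>Zmod n\<^esub> \<ominus>\<^bsub>Zmod n\<^esub> u) \<otimes>\<^bsub>Zmod n\<^esub> x))"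
proof -
  let ?D = "dihedral_quandle n" and ?A = "carrier (Zmod n)"
  interpret cring "Zmod n" by (rule cring_Zmod)
  have "(?D, affine_map n a u) \<cong>\<^sub>v (?D, affine_map n b v) \<longleftrightarrow>
      (\<exists>\<psi>\<in>rack_iso ?D ?D. compose ?A \<psi> (affine_map n a u) = compose ?A (affine_map n b v) \<psi>)"
    by (auto simp: virtual_rack_isomorphic_def virtual_rack_iso_def rack_iso_def
        dihedral_quandle_def simp del: rack_hom.simps)
  also have "\<dots> \<longleftrightarrow> (\<exists>x\<in>?A. \<exists>y\<in>Units (Zmod n).
      compose ?A (affine_map n x y) (affine_map n a u) =
      compose ?A (affine_map n b v) (affine_map n x y))"
    unfolding rack_iso_dihedral_quandle by blast
  also have "\<dots> \<longleftrightarrow> (\<exists>x\<in>?A. \<exists>y\<in>Units (Zmod n). u = v \<and>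
      b = (y \<otimes>\<^bsub>Zmod n\<^esub> a) \<oplus>\<^bsub>Zmod n\<^esub> ((\<one>\<^bsub>Zmod n\<^esub> \<ominus>\<^bsub>Zmod n\<^esub> u) \<otimes>\<^bsub>Zmod n\<^esub> x))"
    using assms(2-5) by (simp add: affine_map_intertwine_iff Units_closed)
  finally show ?thesis
    by (auto simp: holomorph_def)
qed

end
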